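(* Let $1<\alpha\le 2$, $\eta\in(0,1)$, $\beta>0$, let $f:[0,1]\times\mathbb{R}\to[0,\infty)$ be continuous, and let $H_1,H_2:C[0,1]\to[0,\infty)$ be compact functionals. Assume $\beta>\max\{\beta_K,\beta_\gamma\}$. Let $\rho>0$ and assume that: (1) there exists $\underline{\delta}_\rho\in C([0,1],\mathbb{R}^+)$ such that $f(t,u)\ge\underline{\delta}_\rho(t)$ for all $(t,u)\in[0,1]\times[\sigma_1\rho,\rho]$; (2) there exist $\eta_{1,\rho},\eta_{2,\rho}\ge 0$ such that $H_1[u]\ge\eta_{1,\rho}$ and $H_2[u]\ge\eta_{2,\rho}$ for every $u\in P_{\sigma_1}\cap\partial\Omega_\rho$; (3) the inequality $$\gamma(0)\,\eta_{1,\rho}+\eta_{2,\rho}+\int_0^1K(0,s)\,\underline{\delta}_\rho(s)\,ds>0$$ holds. Then there exist $\lambda_\rho>0$ and $u_\rho\in P_{\sigma_1}\cap\overline{\Omega_\rho}$ such that the couple $(\lambda_\rho,u_\rho)$ solves (in the mild sense) the boundary value problem $$\begin{cases}{}^{C}D^{\alpha}u(t)+\lambda f(t,u(t))=0,\quad t\in(0,1),\\ u'(0)+\lambda H_1[u]=0,\\ \beta\,{}^{C}D^{\alpha-1}u(1)+u(\eta)=\lambda H_2[u],\end{cases}$$ and $\sigma_1\rho\le u_\rho(t)\le\rho$ for every $t\in[0,1]$.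
   Context: $C[0,1]$ carries the supremum norm $\|\cdot\|_\infty$; $\Omega_\rho=\{u\in C[0,1]:\|u\|_\infty<\rho\}$, with closure $\overline{\Omega_\rho}$ and boundary $\partial\Omega_\rho=\{u:\|u\|_\infty=\rho\}$. $\mathbb{R}^+=[0,\infty)$. $\Gamma$ is the Gamma function and ${}^{C}D^{\alpha}$ the Caputo fractional derivative of order $\alpha$. "Compact" means continuous and mapping bounded sets to relatively compact sets; $H_1,H_2$ need not be linear. For $t,s\in[0,1]$ put $$\gamma(t)=\frac{\beta}{\Gamma(3-\alpha)}+\eta-t,\qquad K(t,s)=\beta+\frac{(\eta-s)^{\alpha-1}}{\Gamma(\alpha)}\chi_{[0,\eta]}(s)-\frac{(t-s)^{\alpha-1}}{\Gamma(\alpha)}\chi_{[0,t]}(s),$$ where $\chi_A$ is the characteristic function of $A$ (the corresponding term is $0$ when $s\notin A$), and for $u\in C[0,1]$ $$T(u)(t)=H_1[u]\gamma(t)+H_2[u]+\int_0^1K(t,s)f(s,u(s))\,ds .$$ Mild solution: the couple $(\lambda,u)$ with $u\in C[0,1]$ solves the boundary value problem in the mild sense if, by definition, $u(t)=\lambda\,T(u)(t)$ for all $t\in[0,1]$. Thresholds: $\beta_K=\frac{(1-\eta)^{\alpha-1}}{\Gamma(\alpha)}$ and $\beta_\gamma=(1-\eta)\Gamma(3-\alpha)$. Constants and cone: $$c_{1,K}=\frac{\beta\Gamma(\alpha)-(1-\eta)^{\alpha-1}}{\beta\Gamma(\alpha)+\eta^{\alpha-1}},\qquad \sigma_{1,\gamma}=\frac{\beta+(\eta-1)\Gamma(3-\alpha)}{\beta+\eta\,\Gamma(3-\alpha)},\qquad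 \sigma_1=\min\{\sigma_{1,\gamma},1,c_{1,K}\},$$ $$P_{\sigma_1}=\Bigl\{u\in C[0,1]:\ \min_{t\in[0,1]}u(t)\ge\sigma_1\|u\|_\infty\Bigr\}.$$ *)

theory Defs
  imports "HOL-Analysis.Analysis"
begin

section \<open>The space of continuous functions on the unit interval\<close>

text \<open>
  \<^term>\<open>cfunspace\<close> carries the metric of uniform convergence; its elements are extensional, so
  every continuous function on \<open>[0,1]\<close> has exactly one representative in \<open>real \<Rightarrow> real\<close>.
\<close>

abbreviation C01_metric :: "(real \<Rightarrow> real) metric" where
  "C01_metric \<equiv> cfunspace (top_of_set {0..1::real}) euclidean_metric"

abbreviation C01 :: "(real \<Rightarrow> real) set" where
  "C01 \<equiv> mspace C01_metric"

abbreviation C01_topology :: "(real \<Rightarrow> real) topology" where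
  "C01_topology \<equiv> mtopology_of C01_metric"

definition supnorm :: "(real \<Rightarrow> real) \<Rightarrow> real" where
  "supnorm u = (SUP t\<in>{0..1}. \<bar>u t\<bar>)"

definition Omega :: "real \<Rightarrow> (real \<Rightarrow> real) set" where
  "Omega \<rho> = {u \<in> C01. supnorm u < \<rho>}"

definition compact_functional :: "((real \<Rightarrow> real) \<Rightarrow> real) \<Rightarrow> bool" where
  "compact_functional H \<longleftrightarrow>
     continuous_map C01_topology euclideanreal H \<and>
     (\<forall>B\<subseteq>C01. (\<exists>M. \<forall>u\<in>B. supnorm u \<le> M) \<longrightarrow> compact (closure (H ` B)))"

section \<open>The integral operator and mild solutions\<close>

definition gam :: "real \<Rightarrow> real \<Rightarrow> real \<Rightarrow> real \<Rightarrow> real" where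
  "gam \<alpha> \<beta> \<eta> t = \<beta> / Gamma (3 - \<alpha>) + \<eta> - t"

definition kern :: "real \<Rightarrow> real \<Rightarrow> real \<Rightarrow> real \<Rightarrow> real \<Rightarrow> real" where
  "kern \<alpha> \<beta> \<eta> t s =
     \<beta> + (\<eta> - s) powr (\<alpha> - 1) / Gamma \<alpha> * indicat_real {0..\<eta>} s
       - (t - s) powr (\<alpha> - 1) / Gamma \<alpha> * indicat_real {0..t} s"

definition T_op ::
  "real \<Rightarrow> real \<Rightarrow> real \<Rightarrow> (real \<Rightarrow> real \<Rightarrow> real) \<Rightarrow>
   ((real \<Rightarrow> real) \<Rightarrow> real) \<Rightarrow> ((real \<Rightarrow> real) \<Rightarrow> real) \<Rightarrow> (real \<Rightarrow> real) \<Rightarrow> real \<Rightarrow> real" where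
  "T_op \<alpha> \<beta> \<eta> f H1 H2 u t =
     H1 u * gam \<alpha> \<beta> \<eta> t + H2 u + integral {0..1} (\<lambda>s. kern \<alpha> \<beta> \<eta> t s * f s (u s))"

text \<open>
  The boundary value problem
    \<open>\<^sup>CD\<^sup>\<alpha> u(t) + \<lambda> f(t, u(t)) = 0\<close> on \<open>(0,1)\<close>,
    \<open>u'(0) + \<lambda> H\<^sub>1[u] = 0\<close>,
    \<open>\<beta> \<^sup>CD\<^bsup>\<alpha>-1\<^esup> u(1) + u(\<eta>) = \<lambda> H\<^sub>2[u]\<close>
  with Caputo derivatives. A mild solution is by definition a solution of the associated
  perturbed Hammerstein equation; no differentiability of \<open>u\<close> is required.
\<close>

definition mild_solution ::
  "real \<Rightarrow> real \<Rightarrow> real \<Rightarrow> (real \<Rightarrow> real \<Rightarrow> real) \<Rightarrow>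
   ((real \<Rightarrow> real) \<Rightarrow> real) \<Rightarrow> ((real \<Rightarrow> real) \<Rightarrow> real) \<Rightarrow> real \<Rightarrow> (real \<Rightarrow> real) \<Rightarrow> bool" where
  "mild_solution \<alpha> \<beta> \<eta> f H1 H2 lam u \<longleftrightarrow>
     u \<in> C01 \<and> (\<forall>t\<in>{0..1}. u t = lam * T_op \<alpha> \<beta> \<eta> f H1 H2 u t)"

section \<open>Thresholds, constants and the cone\<close>

definition beta_K :: "real \<Rightarrow> real \<Rightarrow> real" where
  "beta_K \<alpha> \<eta> = (1 - \<eta>) powr (\<alpha> - 1) / Gamma \<alpha>"

definition beta_gam :: "real \<Rightarrow> real \<Rightarrow> real" where
  "beta_gam \<alpha> \<eta> = (1 - \<eta>) * Gamma (3 - \<alpha>)"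

definition c1_K :: "real \<Rightarrow> real \<Rightarrow> real \<Rightarrow> real" where
  "c1_K \<alpha> \<beta> \<eta> =
     (\<beta> * Gamma \<alpha> - (1 - \<eta>) powr (\<alpha> - 1)) / (\<beta> * Gamma \<alpha> + \<eta> powr (\<alpha> - 1))"

definition sigma1_gam :: "real \<Rightarrow> real \<Rightarrow> real \<Rightarrow> real" where
  "sigma1_gam \<alpha> \<beta> \<eta> =
     (\<beta> + (\<eta> - 1) * Gamma (3 - \<alpha>)) / (\<beta> + \<eta> * Gamma (3 - \<alpha>))"

definition sigma1 :: "real \<Rightarrow> real \<Rightarrow> real \<Rightarrow> real" where
  "sigma1 \<alpha> \<beta> \<eta> = Min {sigma1_gam \<alpha> \<beta> \<eta>, 1, c1_K \<alpha> \<beta> \<eta>}"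

definition P_cone :: "real \<Rightarrow> (real \<Rightarrow> real) set" where
  "P_cone \<sigma> = {u \<in> C01. (INF t\<in>{0..1}. u t) \<ge> \<sigma> * supnorm u}"

section \<open>Consistency with the library notions\<close>

lemma C01_iff: "u \<in> C01 \<longleftrightarrow> u \<in> extensional {0..1} \<and> continuous_on {0..1} u"
proof -
  have "Metric_space.mbounded (UNIV::real set) dist (u ` {0..1})" if "continuous_on {0..1} u"
    using compact_imp_bounded[OF compact_continuous_image[OF that]] by simp
  then show ?thesis
    by auto
qed

context
  notes mspace_cfunspace [simp del]
begin

lemma C01_bdd:
  assumes "u \<in> C01"
  shows "bdd_above ((\<lambda>t. \<bar>u t\<bar>) ` {0..1})"
proof -
  have "continuous_on {0..1} (\<lambda>t. \<bar>u t\<bar>)"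
    using assms unfolding C01_iff by (auto intro: continuous_intros)
  then show ?thesis
    by (intro bounded_imp_bdd_above compact_imp_bounded compact_continuous_image) auto
qed

lemma supnorm_le_iff: "u \<in> C01 \<Longrightarrow> supnorm u \<le> a \<longleftrightarrow> (\<forall>t\<in>{0..1}. \<bar>u t\<bar> \<le> a)"
  unfolding supnorm_def by (subst cSUP_le_iff) (auto dest: C01_bdd)

lemma C01_restrict: "continuous_on {0..1} g \<Longrightarrow> restrict g {0..1} \<in> C01"
  unfolding C01_iff
  by (metis continuous_on_cong restrict_apply' restrict_extensional)

lemma C01_diff: "u \<in> C01 \<Longrightarrow> v \<in> C01 \<Longrightarrow> (\<lambda>t\<in>{0..1}. u t - v t) \<in> C01"
  by (rule C01_restrict) (auto simp: C01_iff intro: continuous_intros)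

lemma C01_scale: "u \<in> C01 \<Longrightarrow> (\<lambda>t\<in>{0..1}. c * u t) \<in> C01"
  by (rule C01_restrict) (auto simp: C01_iff intro: continuous_intros)

lemma mdist_C01:
  assumes "u \<in> C01" "v \<in> C01"
  shows "mdist C01_metric u v = supnorm (\<lambda>t\<in>{0..1}. u t - v t)"
proof -
  have "mdist C01_metric u v \<le> a \<longleftrightarrow> supnorm (\<lambda>t\<in>{0..1}. u t - v t) \<le> a" for a
    using cfunspace_mdist_le[OF assms] supnorm_le_iff[OF C01_diff[OF assms]]
    by (auto simp: dist_real_def)
  then show ?thesis
    by (meson order.refl order.antisym)
qed

lemma min_attained:
  assumes "u \<in> C01"
  shows "\<exists>t\<in>{0..1}. (INF s\<in>{0..1}. u s) = u t \<and> (\<forall>s\<in>{0..1}. u t \<le> u s)"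
proof -
  obtain t where t: "t \<in> {0..1}" "\<forall>s\<in>{0..1}. u t \<le> u s"
    using continuous_attains_inf[of "{0..1::real}" u] assms unfolding C01_iff by auto
  then have "(INF s\<in>{0..1}. u s) = u t"
    by (intro cInf_eq_minimum) auto
  with t show ?thesis by blast
qed

lemma supnorm_le_add_mdist:
  assumes "u \<in> C01" "v \<in> C01"
  shows "supnorm u \<le> supnorm v + mdist C01_metric u v"
proof -
  have "\<bar>u t\<bar> \<le> supnorm v + mdist C01_metric u v" if t: "t \<in> {0..1}" for t
  proof -
    have "\<bar>v t\<bar> \<le> supnorm v"
      using supnorm_le_iff[OF assms(2), of "supnorm v"] t by blast
    moreover have "\<bar>u t - v t\<bar> \<le> mdist C01_metric u v"
      using cfunspace_mdist_le[OF assms, of "mdist C01_metric u v"] t by (auto simp: dist_real_def)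
    ultimately show ?thesis by linarith
  qed
  then show ?thesis
    using supnorm_le_iff[OF assms(1)] by blast
qed

lemma openin_Omega: "openin C01_topology (Omega \<rho>)"
proof -
  interpret M: Metric_space C01 "mdist C01_metric" by (rule Metric_space_mspace_mdist)
  have "\<exists>r>0. M.mball u r \<subseteq> Omega \<rho>" if u: "u \<in> C01" "supnorm u < \<rho>" for u
  proof (intro exI conjI subsetI)
    show "0 < \<rho> - supnorm u" using u by simp
    fix v assume "v \<in> M.mball u (\<rho> - supnorm u)"
    then have "v \<in> C01" "mdist C01_metric u v < \<rho> - supnorm u" by (auto simp: M.in_mball)
    then show "v \<in> Omega \<rho>"
      using supnorm_le_add_mdist[of v u] u M.commute[of u v] by (auto simp: Omega_def)
  qed
  then show ?thesis
    by (auto simp: mtopology_of_def M.openin_mtopology Omega_def)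
qed

lemma closure_Omega:
  assumes "\<rho> > 0"
  shows "C01_topology closure_of Omega \<rho> = {u \<in> C01. supnorm u \<le> \<rho>}"
proof -
  interpret M: Metric_space C01 "mdist C01_metric" by (rule Metric_space_mspace_mdist)
  have "supnorm u \<le> \<rho>"
    if u: "u \<in> C01" and close: "\<And>r. r > 0 \<Longrightarrow> \<exists>v\<in>Omega \<rho>. v \<in> M.mball u r" for u
  proof (rule field_le_epsilon)
    fix e :: real assume "e > 0"
    then obtain v where "v \<in> Omega \<rho>" "v \<in> M.mball u e" using close by blast
    then show "supnorm u \<le> \<rho> + e"
      using supnorm_le_add_mdist[of u v] u by (auto simp: M.in_mball Omega_def)
  qed
  moreover have "\<exists>v\<in>Omega \<rho>. v \<in> M.mball u r"
    if u: "u \<in> C01" "supnorm u \<le> \<rho>" and "r > 0" for u and r :: real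
  proof -
    define c where "c = max 0 (1 - r / (2 * \<rho>))"
    have c: "0 \<le> c" "c < 1" "(1 - c) * \<rho> < r"
      using \<open>r > 0\<close> assms unfolding c_def by (auto simp: max_def field_simps)
    define v where "v = (\<lambda>t\<in>{0..1}. c * u t)"
    have v: "v \<in> C01" unfolding v_def by (rule C01_scale[OF u(1)])
    have ub: "\<bar>u t\<bar> \<le> \<rho>" if "t \<in> {0..1}" for t
      using supnorm_le_iff[OF u(1)] u(2) that by blast
    have "supnorm v \<le> c * \<rho>"
      using ub c(1) by (subst supnorm_le_iff[OF v]) (auto simp: v_def abs_mult intro: mult_left_mono)
    also have "\<dots> < \<rho>" using c assms by simp
    finally have "v \<in> Omega \<rho>" using v by (simp add: Omega_def)
    moreover have "mdist C01_metric u v \<le> (1 - c) * \<rho>"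
      unfolding mdist_C01[OF u(1) v]
    proof (subst supnorm_le_iff[OF C01_diff[OF u(1) v]], intro ballI)
      fix t :: real assume t: "t \<in> {0..1}"
      have "\<bar>u t - c * u t\<bar> = (1 - c) * \<bar>u t\<bar>"
        using c by (metis abs_mult abs_of_pos diff_gt_0_iff_gt left_diff_distrib mult_1)
      also have "\<dots> \<le> (1 - c) * \<rho>" using c ub[OF t] by (intro mult_left_mono) auto
      finally show "\<bar>(\<lambda>t\<in>{0..1}. u t - v t) t\<bar> \<le> (1 - c) * \<rho>"
        using t by (simp add: v_def)
    qed
    ultimately show ?thesis using c u v by (intro bexI[of _ v]) (auto simp: M.in_mball)
  qed
  ultimately show ?thesis
    unfolding mtopology_of_def M.metric_closure_of by blast
qed

lemma frontier_Omega:
  assumes "\<rho> > 0"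
  shows "C01_topology frontier_of Omega \<rho> = {u \<in> C01. supnorm u = \<rho>}"
  unfolding frontier_of_def interior_of_openin[OF openin_Omega] closure_Omega[OF assms]
  by (auto simp: Omega_def)

end

end

theory Submission
  imports Defs "HOL-Complex_Analysis.Great_Picard"
begin

text \<open>
  This is a Birkhoff--Kellogg theorem in a cone, and the proof turns the eigenvalue problem
  \<open>u = \<lambda> T u\<close> on the sphere \<open>\<parallel>u\<parallel> = \<rho>\<close> into a fixed point problem for Schauder's theorem.

  Since \<open>\<gamma>\<close> and the kernel decrease in \<open>t\<close> and \<open>f\<close>, \<open>H1\<close>, \<open>H2\<close> are nonnegative, \<open>T u\<close> attains its
  maximum at \<open>0\<close>; and \<open>\<sigma>\<close> is chosen such that \<open>T u t \<ge> \<sigma> * T u 0\<close> (lemma \<open>T_bounds\<close>). So for functions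
  in the range of \<open>T\<close> the norm is the value at \<open>0\<close>, which is linear in the function.

  This makes a simple retraction available: \<open>push_out\<close> maps every continuous function to one
  with value \<open>\<rho>\<close> at \<open>0\<close> and all values in \<open>[\<sigma>\<rho>, \<rho>]\<close>, that is, into the cone and onto the sphere.
  There the hypotheses bound \<open>T u 0\<close> from below by a positive constant (\<open>T_lower_bound\<close>), so
  \<open>v \<mapsto> \<rho> T (push_out v) / T (push_out v) 0\<close> is continuous on the whole space and has an
  equicontinuous, bounded range. Its fixed points are unaffected by \<open>push_out\<close> and solve the
  problem with \<open>\<lambda> = \<rho> / T u 0\<close> (\<open>T_eigenfunction\<close>).

  Schauder's theorem is derived from Kuhn's combinatorial lemma by way of Brouwer's theorem for the
  Hilbert cube, in which all finite dimensions are treated at once.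
\<close>

section \<open>Schauder's fixed point theorem\<close>

lemma dist_fun_le_coordinates:
  fixes x y :: "nat \<Rightarrow> real"
  assumes "\<And>i. \<bar>x i - y i\<bar> \<le> c"
  shows "dist x y \<le> 2 * c"
proof -
  let ?d = "\<lambda>n. (1/2::real) ^ n * min (dist (x (from_nat n)) (y (from_nat n))) 1"
  have s: "summable (\<lambda>n. (1/2::real) ^ n)"
    by (rule summable_geometric) simp
  have le: "?d n \<le> (1/2) ^ n * c" for n
    using assms[of "from_nat n"] by (intro mult_left_mono) (auto simp: dist_real_def)
  have "summable ?d"
    by (rule summable_comparison_test'[OF s, of 0]) (auto simp: abs_mult)
  then have "dist x y \<le> (\<Sum>n. (1/2::real) ^ n * c)"
    unfolding dist_fun_def using le s by (intro suminf_le) (auto intro: summable_mult2)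
  also have "\<dots> = 2 * c"
    using suminf_mult2[OF s, of c] suminf_geometric[of "1/2::real"] by simp
  finally show ?thesis .
qed

lemma compact_Hilbert_cube: "compact (UNIV \<rightarrow> {0..1} :: (nat \<Rightarrow> real) set)"
proof -
  have "compactin (product_topology (\<lambda>_. euclidean) UNIV) (PiE UNIV (\<lambda>_::nat. {0..1::real}))"
    by (subst compactin_PiE) auto
  then show ?thesis
    by (simp only: euclidean_product_topology PiE_UNIV_domain compactin_euclidean_iff)
qed

text \<open>
  Kuhn's labelling lemma applied to the grid of mesh \<open>1/p\<close> on the first \<open>n\<close> coordinates: a vertex
  gets label \<open>0\<close> in coordinate \<open>i\<close> where \<open>F\<close> moves it up and \<open>1\<close> where \<open>F\<close> moves it down. In the small
  cube that Kuhn's lemma provides, every \<open>F x i - x i\<close> with \<open>i < n\<close> is \<open>\<ge> 0\<close> at one vertex and \<open>\<le> 0\<close> at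
  another, so by uniform continuity it is small at every vertex.
\<close>
lemma Hilbert_cube_almost_fixed_coordinates:
  fixes F :: "(nat \<Rightarrow> real) \<Rightarrow> nat \<Rightarrow> real"
  assumes cont: "continuous_on (UNIV \<rightarrow> {0..1}) F"
    and maps: "F \<in> (UNIV \<rightarrow> {0..1}) \<rightarrow> (UNIV \<rightarrow> {0..1})"
    and "e > 0"
  obtains x where "x \<in> UNIV \<rightarrow> {0..1}" "\<And>i. i < n \<Longrightarrow> \<bar>F x i - x i\<bar> < e"
proof -
  let ?Q = "UNIV \<rightarrow> {0..1} :: (nat \<Rightarrow> real) set"
  have F01: "0 \<le> F x i" "F x i \<le> 1" if "x \<in> ?Q" for x i
  proof -
    have "F x \<in> ?Q" using maps that by blast
    then show "0 \<le> F x i" "F x i \<le> 1" by (auto simp: Pi_iff)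
  qed
  define \<phi> where "\<phi> i x = F x i - x i" for i x
  have "uniformly_continuous_on ?Q (\<phi> i)" for i
    unfolding \<phi>_def
    by (intro compact_uniformly_continuous compact_Hilbert_cube continuous_on_diff
          continuous_on_product_then_coordinatewise[OF cont]
          continuous_on_product_then_coordinatewise[OF continuous_on_id])
  then have "\<exists>d>0. \<forall>x\<in>?Q. \<forall>y\<in>?Q. dist y x < d \<longrightarrow> dist (\<phi> i y) (\<phi> i x) < e" for i
    using \<open>e > 0\<close> unfolding uniformly_continuous_on_def by blast
  then obtain d where d: "\<And>i. d i > 0"
    and dd: "\<And>i x y. x \<in> ?Q \<Longrightarrow> y \<in> ?Q \<Longrightarrow> dist y x < d i \<Longrightarrow> dist (\<phi> i y) (\<phi> i x) < e"
    by metis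
  define d0 where "d0 = Min (insert 1 (d ` {..<n}))"
  have "d0 > 0" and d0: "d0 \<le> d i" if "i < n" for i
    using d that by (auto simp: d0_def)
  then have "d0 > 0"
    by (cases n) (auto simp: d0_def)
  then obtain p :: nat where p: "p > 0" "1 / p < d0 / 2"
    using real_arch_inverse[of "d0/2"] by (auto simp: inverse_eq_divide)
  define pt where "pt y i = (if i < n then real (y i) / p else 0)" for y :: "nat \<Rightarrow> nat" and i
  have ptQ: "pt y \<in> ?Q" if "\<forall>i<n. y i \<le> p" for y
    using that p by (auto simp: pt_def field_simps)
  \<comment> \<open>The clause for \<open>p\<close> forces label \<open>1\<close> on the upper face, where \<open>F\<close> cannot increase the
    coordinate.\<close>
  define label where
    "label y i = (if \<phi> i (pt y) \<ge> 0 \<and> y i \<noteq> p then 0 else 1 :: nat)" for y i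
  obtain q where q: "\<forall>i<n. q i < p" and
    rs: "\<forall>i<n. \<exists>r s. (\<forall>j<n. q j \<le> r j \<and> r j \<le> q j + 1) \<and>
            (\<forall>j<n. q j \<le> s j \<and> s j \<le> q j + 1) \<and> label r i \<noteq> label s i"
  proof (rule kuhn_lemma[of p n label])
    show "\<forall>x. (\<forall>i<n. x i \<le> p) \<longrightarrow> (\<forall>i<n. x i = 0 \<longrightarrow> label x i = 0)"
      using p F01(1)[OF ptQ] by (auto simp: label_def \<phi>_def pt_def)
  qed (use p in \<open>auto simp: label_def\<close>)
  have q': "\<forall>i<n. q i \<le> p" using q by auto
  have near: "\<bar>\<phi> i (pt r) - \<phi> i (pt q)\<bar> < e" "pt r \<in> ?Q"
    if "i < n" and r: "\<forall>j<n. q j \<le> r j \<and> r j \<le> q j + 1" for i r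
  proof -
    show rQ: "pt r \<in> ?Q"
      using r q by (intro ptQ) (metis Suc_eq_plus1 Suc_leI le_trans)
    have "\<bar>pt r j - pt q j\<bar> \<le> 1 / p" for j
    proof (cases "j < n")
      case True
      then have "real (q j) \<le> r j" "real (r j) \<le> q j + 1" using r by (auto simp flip: of_nat_Suc)
      then have "\<bar>real (r j) - q j\<bar> / p \<le> 1 / p" by (intro divide_right_mono) auto
      then show ?thesis using True p by (simp add: pt_def flip: diff_divide_distrib)
    qed (simp add: pt_def)
    then have "dist (pt r) (pt q) \<le> 2 * (1 / p)"
      by (rule dist_fun_le_coordinates)
    also have "\<dots> < d i" using p d0[OF \<open>i < n\<close>] by auto
    finally show "\<bar>\<phi> i (pt r) - \<phi> i (pt q)\<bar> < e"
      using dd[OF ptQ[OF q'] rQ, of i] by (simp add: dist_real_def)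
  qed
  have "\<bar>\<phi> i (pt q)\<bar> < e" if i: "i < n" for i
  proof -
    have sign: "(label r i = 0 \<longrightarrow> \<phi> i (pt r) \<ge> 0) \<and> (label r i \<noteq> 0 \<longrightarrow> \<phi> i (pt r) \<le> 0)"
      if "\<forall>j<n. q j \<le> r j \<and> r j \<le> q j + 1" for r
      using F01(2)[OF near(2)[OF i that], of i] i p
      by (auto simp: label_def \<phi>_def pt_def)
    obtain r s where r: "\<forall>j<n. q j \<le> r j \<and> r j \<le> q j + 1"
      and s: "\<forall>j<n. q j \<le> s j \<and> s j \<le> q j + 1" and "label r i \<noteq> label s i"
      using rs i by blast
    moreover have "label r i = 0 \<or> label s i = 0" "label r i \<noteq> 0 \<or> label s i \<noteq> 0"
      using \<open>label r i \<noteq> label s i\<close> by (auto simp only: label_def split: if_splits)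
    ultimately show ?thesis
      using sign[OF r] sign[OF s] near(1)[OF i r] near(1)[OF i s] by linarith
  qed
  then show thesis
    using that[OF ptQ[OF q']] by (auto simp: \<phi>_def)
qed

text \<open>
  The dimension of a Euclidean space is fixed by its type, whereas Schauder's theorem needs
  Brouwer's theorem in all dimensions at once. The Hilbert cube contains all of them as faces, and its
  compactness in the product metric turns points that are almost fixed in more and more coordinates
  into a fixed point.
\<close>
theorem Brouwer_Hilbert_cube:
  fixes F :: "(nat \<Rightarrow> real) \<Rightarrow> nat \<Rightarrow> real"
  assumes cont: "continuous_on (UNIV \<rightarrow> {0..1}) F"
    and maps: "F \<in> (UNIV \<rightarrow> {0..1}) \<rightarrow> (UNIV \<rightarrow> {0..1})"
  obtains x where "x \<in> UNIV \<rightarrow> {0..1}" "F x = x"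
proof -
  let ?Q = "UNIV \<rightarrow> {0..1} :: (nat \<Rightarrow> real) set"
  have "\<exists>x\<in>?Q. \<forall>i<n. \<bar>F x i - x i\<bar> < inverse (real (Suc n))" for n
    using Hilbert_cube_almost_fixed_coordinates[OF cont maps, of "inverse (real (Suc n))" n]
    by (metis inverse_positive_iff_positive of_nat_0_less_iff zero_less_Suc)
  then obtain X where XQ: "\<And>n. X n \<in> ?Q"
    and X: "\<And>n i. i < n \<Longrightarrow> \<bar>F (X n) i - X n i\<bar> < inverse (real (Suc n))"
    by metis
  obtain x k where x: "x \<in> ?Q" and k: "strict_mono k" and lim: "(X \<circ> k) \<longlonglongrightarrow> x"
  proof (rule seq_compactE)
    show "seq_compact ?Q"
      using compact_Hilbert_cube by (simp only: compact_eq_seq_compact_metric)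
    show "\<forall>n. X n \<in> ?Q" using XQ by blast
  qed
  have "F x i - x i = 0" for i
  proof (rule LIMSEQ_unique)
    have "continuous_on ?Q (\<lambda>x. F x i - x i)"
      by (intro continuous_on_diff continuous_on_product_then_coordinatewise[OF cont]
            continuous_on_product_then_coordinatewise[OF continuous_on_id])
    then show "(\<lambda>n. F ((X \<circ> k) n) i - (X \<circ> k) n i) \<longlonglongrightarrow> F x i - x i"
      by (rule continuous_on_tendsto_compose[OF _ lim x]) (use XQ in auto)
    have "(\<lambda>n. inverse (real (Suc (k n)))) \<longlonglongrightarrow> 0"
      using LIMSEQ_subseq_LIMSEQ[OF LIMSEQ_inverse_real_of_nat k] by (simp add: o_def)
    then show "(\<lambda>n. F ((X \<circ> k) n) i - (X \<circ> k) n i) \<longlonglongrightarrow> 0"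
    proof (rule Lim_null_comparison[rotated])
      show "\<forall>\<^sub>F n in sequentially.
              norm (F ((X \<circ> k) n) i - (X \<circ> k) n i) \<le> inverse (real (Suc (k n)))"
      proof (rule eventually_sequentiallyI)
        fix n assume "Suc i \<le> n"
        then have "i < k n" using seq_suble[OF k, of n] by linarith
        from X[OF this] show "norm (F ((X \<circ> k) n) i - (X \<circ> k) n i) \<le> inverse (real (Suc (k n)))"
          by (simp add: less_imp_le)
      qed
    qed
  qed
  then show thesis using that[OF x] by (auto intro!: ext)
qed

text \<open>
  The Schauder projection onto a finite \<open>e\<close>-net \<open>y 0, \<dots>, y (n-1)\<close> of the compact set displaces its
  points by at most \<open>e\<close>, and it factors through the weights of the partition of unity. So it suffices
  to find a fixed weight vector, and the Hilbert cube provides one: the first \<open>n\<close> coordinates of a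
  cube point are read as weights.
\<close>
lemma Schauder_almost_fixed_point:
  fixes f :: "'a::real_normed_vector \<Rightarrow> 'a"
  assumes C: "convex C" "C \<noteq> {}" and K: "compact K" "K \<subseteq> C"
    and cont: "continuous_on C f" and maps: "f ` C \<subseteq> K" and "e > 0"
  obtains u where "u \<in> C" "norm (u - f u) \<le> e"
proof -
  let ?Q = "UNIV \<rightarrow> {0..1} :: (nat \<Rightarrow> real) set"
  obtain T where T: "finite T" "T \<subseteq> K" "K \<subseteq> (\<Union>y\<in>T. ball y e)"
    using compactE_image[OF K(1), of K "\<lambda>y. ball y e"] \<open>e > 0\<close> by (metis UN_I centre_in_ball open_ball subsetI)
  obtain n and y :: "nat \<Rightarrow> 'a" where y: "T = y ` {i. i < n}"
    using finite_imp_nat_seg_image_inj_on[OF T(1)] by metis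
  have "n > 0"
    using T(3) C(2) maps y by (cases n) auto
  have yC: "y i \<in> C" if "i < n" for i
    using that T(2) K(2) y by auto
  define w where "w i z = max 0 (e - dist z (y i))" for i z
  define W where "W z = (\<Sum>i<n. w i z)" for z
  have W_pos: "W z > 0" if "z \<in> K" for z
  proof -
    have "z \<in> (\<Union>x\<in>T. ball x e)" using T(3) that by blast
    then obtain i where "i < n" "dist z (y i) < e"
      unfolding y by (auto simp: dist_commute)
    then show ?thesis
      unfolding W_def by (intro sum_pos2[of _ i]) (auto simp: w_def)
  qed
  define S where "S x = (\<Sum>i<n. x i)" for x :: "nat \<Rightarrow> real"
  \<comment> \<open>The weights must be defined for all \<open>x\<close> in the cube and add up to \<open>1\<close>; they are the
    coordinates themselves when these add up to \<open>1\<close>.\<close>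
  define c where "c i x = (x i + max 0 (1 - S x) / n) / max 1 (S x)" for i x
  define Y where "Y x = (\<Sum>i<n. c i x *\<^sub>R y i)" for x
  have YC: "Y x \<in> C" if "x \<in> ?Q" for x
    unfolding Y_def
  proof (rule convex_sum[OF _ C(1)])
    have "(\<Sum>i<n. c i x) = (S x + max 0 (1 - S x)) / max 1 (S x)"
      using \<open>n > 0\<close> by (simp add: c_def S_def sum_divide_distrib[symmetric] sum.distrib)
    then show "(\<Sum>i<n. c i x) = 1" by (auto simp: max_def)
    show "0 \<le> c i x" for i using that by (auto simp: c_def Pi_iff)
  qed (auto simp: yC)
  have contS: "continuous_on ?Q S"
    unfolding S_def by (intro continuous_intros continuous_on_subset[OF continuous_on_product_coordinates]) auto
  have contY: "continuous_on ?Q Y"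
    unfolding Y_def c_def
    by (intro continuous_intros contS continuous_on_subset[OF continuous_on_product_coordinates]) auto
  have contfY: "continuous_on ?Q (\<lambda>x. f (Y x))"
    by (rule continuous_on_compose2[OF cont contY]) (use YC in auto)
  have fYK: "f (Y x) \<in> K" if "x \<in> ?Q" for x
    using YC[OF that] maps by auto
  define F where "F x i = (if i < n then w i (f (Y x)) / W (f (Y x)) else 0)" for x i
  have "continuous_on ?Q F"
  proof (rule continuous_on_coordinatewise_then_product)
    fix i
    have cw: "continuous_on ?Q (\<lambda>x. w i (f (Y x)))" for i
      unfolding w_def by (intro continuous_intros contfY)
    have "W (f (Y x)) \<noteq> 0" if "x \<in> ?Q" for x
      using W_pos[OF fYK[OF that]] by simp
    then have "continuous_on ?Q (\<lambda>x. w i (f (Y x)) / W (f (Y x)))"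
      unfolding W_def by (intro continuous_on_divide continuous_on_sum cw) auto
    then show "continuous_on ?Q (\<lambda>x. F x i)"
      unfolding F_def by (cases "i < n") auto
  qed
  moreover have "F \<in> ?Q \<rightarrow> ?Q"
  proof (intro Pi_I)
    fix x i assume "x \<in> ?Q"
    then have "W (f (Y x)) > 0" using W_pos fYK by auto
    moreover have "w i (f (Y x)) \<le> W (f (Y x))" if "i < n"
      unfolding W_def using that by (intro member_le_sum) (auto simp: w_def)
    ultimately show "F x i \<in> {0..1}" by (auto simp: F_def w_def)
  qed
  ultimately obtain x where x: "x \<in> ?Q" "F x = x"
    by (rule Brouwer_Hilbert_cube)
  define z where "z = f (Y x)"
  have Wz: "W z > 0" using W_pos fYK x by (auto simp: z_def)
  have xi: "x i = w i z / W z" if "i < n" for i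
    using fun_cong[OF x(2), of i] that by (simp add: F_def z_def)
  \<comment> \<open>A fixed point is a value of the partition of unity, so its coordinates are genuine weights.\<close>
  have S1: "S x = 1"
    using Wz by (simp add: S_def xi sum_divide_distrib[symmetric]) (simp add: W_def)
  have "Y x - z = (\<Sum>i<n. x i *\<^sub>R (y i - z))"
    using S1 by (simp add: Y_def c_def scaleR_diff_right sum_subtractf S_def flip: scaleR_sum_left)
  also have "norm \<dots> \<le> (\<Sum>i<n. x i * e)"
  proof (rule sum_norm_le)
    fix i assume "i \<in> {..<n}"
    then have i: "i < n" by simp
    have "x i \<ge> 0" using x(1) by (auto simp: Pi_iff)
    moreover have "norm (y i - z) \<le> e" if "x i \<noteq> 0"
      using that xi[OF i] Wz by (auto simp: w_def max_def dist_norm norm_minus_commute split: if_splits)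
    ultimately show "norm (x i *\<^sub>R (y i - z)) \<le> x i * e"
      by (cases "x i = 0") (auto intro!: mult_left_mono)
  qed
  also have "\<dots> = e" using S1 by (simp add: S_def flip: sum_distrib_right)
  finally show thesis using that[OF YC[OF x(1)]] by (simp add: z_def)
qed

theorem Schauder_fixed_point:
  fixes f :: "'a::real_normed_vector \<Rightarrow> 'a"
  assumes C: "convex C" "C \<noteq> {}" and K: "compact K" "K \<subseteq> C"
    and cont: "continuous_on C f" and maps: "f ` C \<subseteq> K"
  obtains u where "u \<in> C" "f u = u"
proof -
  have "\<exists>u\<in>C. norm (u - f u) \<le> inverse (real (Suc n))" for n
    using Schauder_almost_fixed_point[OF assms, of "inverse (real (Suc n))"]
    by (metis inverse_positive_iff_positive of_nat_0_less_iff zero_less_Suc)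
  then obtain U where UC: "\<And>n. U n \<in> C" and U: "\<And>n. norm (U n - f (U n)) \<le> inverse (real (Suc n))"
    by metis
  have "\<forall>n. f (U n) \<in> K" using UC maps by auto
  then obtain z k where z: "z \<in> K" and k: "strict_mono k" and lim: "((\<lambda>n. f (U n)) \<circ> k) \<longlonglongrightarrow> z"
    using K(1) unfolding compact_eq_seq_compact_metric seq_compact_def by metis
  have "(\<lambda>n. U n - f (U n)) \<longlonglongrightarrow> 0"
    using LIMSEQ_inverse_real_of_nat by (rule Lim_null_comparison[rotated]) (use U in auto)
  from tendsto_add[OF LIMSEQ_subseq_LIMSEQ[OF this k] lim]
  have Uk: "(\<lambda>n. U (k n)) \<longlonglongrightarrow> z" by (simp add: o_def)
  have "(\<lambda>n. f (U (k n))) \<longlonglongrightarrow> f z"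
    by (rule continuous_on_tendsto_compose[OF cont Uk]) (use z K UC in auto)
  with lim have "f z = z" by (auto simp: o_def intro: LIMSEQ_unique)
  then show thesis using that z K by auto
qed

text \<open>
  The compact set to which Schauder's theorem will be applied. A function on \<open>{a..b}\<close> is identified
  with its extension to the line by constants, which makes \<open>C[a,b]\<close> a subspace of a normed space
  given by a type; compactness is then the Arzela--Ascoli theorem.
\<close>
lemma compact_equicontinuous_clamped:
  fixes a b B :: real and \<omega> :: "real \<Rightarrow> real"
  assumes ab: "a \<le> b" and \<omega>: "(\<omega> \<longlongrightarrow> 0) (at 0)" "\<omega> 0 = 0"
  shows "compact {v :: real \<Rightarrow>\<^sub>C real. (\<forall>t. \<bar>v t\<bar> \<le> B) \<and> (\<forall>s t. \<bar>v s - v t\<bar> \<le> \<omega> (s - t)) \<and>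
                    (\<forall>t. v t = v (clamp a b t))}" (is "compact ?K")
  unfolding compact_eq_seq_compact_metric seq_compact_def
proof (intro allI impI)
  fix V :: "nat \<Rightarrow> real \<Rightarrow>\<^sub>C real"
  assume V: "\<forall>n. V n \<in> ?K"
  have cl: "clamp a b t \<in> {a..b}" for t
    using clamp_in_interval[of a b t] ab by simp
  obtain g k where k: "strict_mono (k :: nat \<Rightarrow> nat)"
    and g: "\<And>e. 0 < e \<Longrightarrow> \<exists>N. \<forall>n x. n \<ge> N \<and> x \<in> {a..b} \<longrightarrow> norm (V (k n) x - g x) < e"
  proof (rule Arzela_Ascoli[of "{a..b}" "\<lambda>n. apply_bcontfun (V n)" B])
    fix x e :: real assume "0 < e"
    then obtain d where d: "d > 0" "\<And>h. h \<noteq> 0 \<Longrightarrow> \<bar>h\<bar> < d \<Longrightarrow> \<bar>\<omega> h\<bar> < e"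
      using LIM_D[OF \<omega>(1), of e] by auto
    have "norm (V n x - V n y) < e" if "norm (x - y) < d" for n y
    proof -
      have "\<bar>V n x - V n y\<bar> \<le> \<omega> (x - y)" using V by blast
      also have "\<dots> < e" using d(2)[of "x - y"] that \<omega>(2) \<open>0 < e\<close> by (cases "x = y") auto
      finally show ?thesis by simp
    qed
    then show "\<exists>d>0. \<forall>n y. y \<in> {a..b} \<and> norm (x - y) < d \<longrightarrow> norm (V n x - V n y) < e"
      using d(1) by blast
  qed (use V in auto)
  define G where "G t = g (clamp a b t)" for t
  have "uniform_limit UNIV (\<lambda>n. V (k n)) G sequentially"
  proof (rule uniform_limitI)
    fix e :: real assume "e > 0"
    then obtain N where N: "\<And>n x. n \<ge> N \<Longrightarrow> x \<in> {a..b} \<Longrightarrow> norm (V (k n) x - g x) < e"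
      using g by blast
    show "\<forall>\<^sub>F n in sequentially. \<forall>t\<in>UNIV. dist (V (k n) t) (G t) < e"
    proof (intro eventually_sequentiallyI ballI)
      fix n t assume "N \<le> n"
      have "V (k n) t = V (k n) (clamp a b t)" using V by blast
      then show "dist (V (k n) t) (G t) < e"
        using N[OF \<open>N \<le> n\<close> cl] by (metis G_def dist_norm)
    qed
  qed
  then obtain l where l: "G = apply_bcontfun l" "(\<lambda>n. V (k n)) \<longlonglongrightarrow> l"
    by (rule uniform_limit_bcontfunE) auto
  have pt: "(\<lambda>n. V (k n) t) \<longlonglongrightarrow> l t" for t
    using tendsto_bcontfun_uniform_limit[OF l(2)] by (rule tendsto_uniform_limitI) simp
  have "\<bar>l t\<bar> \<le> B" for t
    by (rule LIMSEQ_le_const2[OF tendsto_rabs[OF pt]]) (use V in blast)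
  moreover have "\<bar>l s - l t\<bar> \<le> \<omega> (s - t)" for s t
    by (rule LIMSEQ_le_const2[OF tendsto_rabs[OF tendsto_diff[OF pt pt]]]) (use V in blast)
  moreover have "l t = l (clamp a b t)" for t
  proof (rule LIMSEQ_unique[OF pt])
    have "V (k n) t = V (k n) (clamp a b t)" for n using V by blast
    then show "(\<lambda>n. V (k n) t) \<longlonglongrightarrow> l (clamp a b t)" using pt[of "clamp a b t"] by simp
  qed
  ultimately have "l \<in> ?K" by blast
  then show "\<exists>l\<in>?K. \<exists>r. strict_mono r \<and> (V \<circ> r) \<longlonglongrightarrow> l"
    using k l(2) by (auto simp: o_def)
qed

section \<open>Truncated powers\<close>

text \<open>
  The truncation \<open>x\<^sub>+\<^sup>a\<close> absorbs the characteristic functions in the kernel, so that the kernel becomes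
  a combination of continuous functions.
\<close>
definition tpow :: "real \<Rightarrow> real \<Rightarrow> real" where
  "tpow a x = max 0 x powr a"

lemma tpow_nonneg: "0 \<le> tpow a x"
  by (simp add: tpow_def)

lemma tpow_mono: "0 \<le> a \<Longrightarrow> x \<le> y \<Longrightarrow> tpow a x \<le> tpow a y"
  unfolding tpow_def by (intro powr_mono2) auto

lemma tpow_eq: "0 \<le> x \<Longrightarrow> tpow a x = x powr a"
  by (simp add: tpow_def)

lemma tpow_eq_0: "x \<le> 0 \<Longrightarrow> tpow a x = 0"
  by (simp add: tpow_def max_def)

lemma continuous_on_tpow [continuous_intros]:
  fixes g :: "'a::topological_space \<Rightarrow> real"
  assumes "0 < a" "continuous_on S g"
  shows "continuous_on S (\<lambda>x. tpow a (g x))"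
  unfolding tpow_def using assms by (intro continuous_on_powr' continuous_intros) auto

text \<open>
  The function \<open>z \<mapsto> z\<^sup>a\<close> lies above the identity on \<open>[0,1]\<close>; apply this to \<open>x/(x+y)\<close> and \<open>y/(x+y)\<close>,
  which add up to \<open>1\<close>. Both the lower bound for the kernel and the equicontinuity of the range of the
  integral operator rest on this inequality.
\<close>
lemma powr_subadditive:
  fixes a x y :: real
  assumes "0 < a" "a \<le> 1" "0 \<le> x" "0 \<le> y"
  shows "(x + y) powr a \<le> x powr a + y powr a"
proof (cases "x + y = 0")
  case True
  then show ?thesis by simp
next
  case False
  then have pos: "0 < x + y" using assms by simp
  have "z \<le> z powr a" if "0 \<le> z" "z \<le> 1" for z :: real
    using powr_mono'[of a 1 z] that assms by (cases "z = 0") auto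
  then have le: "z / (x + y) \<le> z powr a / (x + y) powr a" if "0 \<le> z" "z \<le> x + y" for z
    using that pos by (metis divide_le_eq_1_pos divide_nonneg_pos powr_divide less_imp_le)
  have "1 = x / (x + y) + y / (x + y)"
    using pos by (simp add: add_divide_distrib[symmetric])
  also have "\<dots> \<le> (x powr a + y powr a) / (x + y) powr a"
    using le[of x] le[of y] assms by (simp add: add_divide_distrib)
  finally show ?thesis
    using pos by (simp add: le_divide_eq)
qed

lemma tpow_add_le:
  assumes "0 < a" "a \<le> 1" "0 \<le> h"
  shows "tpow a (x + h) \<le> tpow a x + h powr a"
proof -
  have "tpow a (x + h) \<le> (max 0 x + h) powr a"
    unfolding tpow_def using assms by (intro powr_mono2) auto
  also have "\<dots> \<le> tpow a x + h powr a"
    unfolding tpow_def using assms by (intro powr_subadditive) auto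
  finally show ?thesis .
qed

lemma tpow_Hoelder:
  assumes "0 < a" "a \<le> 1"
  shows "\<bar>tpow a x - tpow a y\<bar> \<le> \<bar>x - y\<bar> powr a"
proof (cases "x \<le> y")
  case True
  then show ?thesis
    using tpow_add_le[OF assms, of "y - x" x] tpow_mono[of a x y] assms by auto
next
  case False
  then show ?thesis
    using tpow_add_le[OF assms, of "x - y" y] tpow_mono[of a y x] assms by auto
qed

section \<open>Compact functionals and the cone\<close>

lemma bounded_linear_apply_bcontfun:
  "bounded_linear (\<lambda>v :: 'a::topological_space \<Rightarrow>\<^sub>C 'b::real_normed_vector. v t)"
  by (rule bounded_linear_intro[of _ 1]) (auto simp: norm_bounded)

text \<open>
  Membership in \<open>C01\<close> is used as a unit; unfolding it would expose the bounded-range condition of the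
  function space.
\<close>
declare mspace_cfunspace [simp del]

lemma compact_functional_bounded:
  assumes "compact_functional H"
  obtains b where "\<And>u. u \<in> C01 \<Longrightarrow> supnorm u \<le> M \<Longrightarrow> \<bar>H u\<bar> \<le> b"
proof -
  let ?B = "{u \<in> C01. supnorm u \<le> M}"
  have "?B \<subseteq> C01" "\<exists>M. \<forall>u\<in>?B. supnorm u \<le> M" by auto
  then have "compact (closure (H ` ?B))"
    using assms unfolding compact_functional_def by (metis (no_types, lifting))
  then have "bounded (H ` ?B)"
    by (rule bounded_subset[OF compact_imp_bounded closure_subset])
  then obtain b where "\<forall>y \<in> H ` ?B. \<bar>y\<bar> \<le> b"
    unfolding bounded_iff by auto
  then show thesis by (intro that[of b]) simp
qed

lemma on_sphere_in_cone:
  assumes "u \<in> C01" "0 \<le> c" "\<And>t. t \<in> {0..1} \<Longrightarrow> c * \<rho> \<le> u t" "\<And>t. t \<in> {0..1} \<Longrightarrow> u t \<le> \<rho>" "u 0 = \<rho>"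
    and "\<rho> > 0"
  shows "supnorm u = \<rho>" "u \<in> P_cone c"
proof -
  have ab: "\<bar>u t\<bar> = u t" if "t \<in> {0..1}" for t
    using assms(3)[OF that] assms(2,6) by (simp add: order_trans[rotated])
  have "supnorm u \<le> \<rho>"
    using supnorm_le_iff[OF assms(1)] ab assms(4) by simp
  moreover have "\<rho> \<le> supnorm u"
    using supnorm_le_iff[OF assms(1), of "supnorm u"] ab[of 0] assms(5) by force
  ultimately show "supnorm u = \<rho>" by simp
  then show "u \<in> P_cone c"
    unfolding P_cone_def using assms by (auto intro: cINF_greatest)
qed

section \<open>Estimates for the kernel\<close>

locale bvp_parameters =
  fixes \<alpha> \<beta> \<eta> :: real
  assumes \<alpha>: "1 < \<alpha>" "\<alpha> \<le> 2" and \<eta>: "0 < \<eta>" "\<eta> < 1" and \<beta>: "0 < \<beta>"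
    and beta: "\<beta> > max (beta_K \<alpha> \<eta>) (beta_gam \<alpha> \<eta>)"
begin

abbreviation "\<sigma> \<equiv> sigma1 \<alpha> \<beta> \<eta>"
abbreviation "\<gamma> \<equiv> gam \<alpha> \<beta> \<eta>"
abbreviation "K \<equiv> kern \<alpha> \<beta> \<eta>"
abbreviation "\<Gamma> \<equiv> Gamma \<alpha>"

lemma Gamma_alpha_pos: "0 < \<Gamma>"
  using \<alpha> by (simp add: Gamma_real_pos)

lemma Gamma_3_minus_alpha_pos: "0 < Gamma (3 - \<alpha>)"
  using \<alpha> by (simp add: Gamma_real_pos)

lemma sigma1_le: "\<sigma> \<le> 1" "\<sigma> \<le> sigma1_gam \<alpha> \<beta> \<eta>" "\<sigma> \<le> c1_K \<alpha> \<beta> \<eta>"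
  by (auto simp: sigma1_def)

lemma sigma1_pos: "0 < \<sigma>"
proof -
  have "beta_K \<alpha> \<eta> < \<beta>" "beta_gam \<alpha> \<eta> < \<beta>" using beta by auto
  then have 1: "0 < \<beta> * \<Gamma> - (1 - \<eta>) powr (\<alpha> - 1)" "0 < \<beta> + (\<eta> - 1) * Gamma (3 - \<alpha>)"
    using Gamma_alpha_pos by (auto simp: beta_K_def beta_gam_def field_simps)
  have 2: "0 < \<beta> * \<Gamma> + \<eta> powr (\<alpha> - 1)" "0 < \<beta> + \<eta> * Gamma (3 - \<alpha>)"
    using \<beta> \<eta> Gamma_alpha_pos Gamma_3_minus_alpha_pos by (auto intro: add_pos_nonneg add_pos_pos)
  from 1 2 show ?thesis
    by (auto simp: sigma1_def c1_K_def sigma1_gam_def)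
qed

lemma gam_0_pos: "0 < \<gamma> 0"
  using \<beta> \<eta> Gamma_3_minus_alpha_pos by (simp add: gam_def add_pos_pos)

text \<open>
  The affine function \<open>\<gamma>\<close> decreases, and \<open>sigma1_gam\<close> is exactly the quotient \<open>\<gamma> 1 / \<gamma> 0\<close>.
\<close>
lemma gam_bounds:
  assumes "t \<in> {0..1}"
  shows "\<sigma> * \<gamma> 0 \<le> \<gamma> t" "\<gamma> t \<le> \<gamma> 0"
proof -
  have pos: "0 < \<beta> + \<eta> * Gamma (3 - \<alpha>)"
    using \<beta> \<eta> Gamma_3_minus_alpha_pos by (auto intro: add_pos_pos)
  have \<gamma>0: "\<gamma> 0 = (\<beta> + \<eta> * Gamma (3 - \<alpha>)) / Gamma (3 - \<alpha>)"
    using Gamma_3_minus_alpha_pos by (simp add: gam_def field_simps)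
  have "\<sigma> * \<gamma> 0 \<le> sigma1_gam \<alpha> \<beta> \<eta> * \<gamma> 0"
    using sigma1_le gam_0_pos by (intro mult_right_mono) auto
  also have "\<dots> = (\<beta> + (\<eta> - 1) * Gamma (3 - \<alpha>)) / Gamma (3 - \<alpha>)"
    unfolding sigma1_gam_def \<gamma>0 using pos by simp
  also have "\<dots> = \<gamma> 1"
    using Gamma_3_minus_alpha_pos by (simp add: gam_def field_simps)
  also have "\<dots> \<le> \<gamma> t" using assms by (simp add: gam_def)
  finally show "\<sigma> * \<gamma> 0 \<le> \<gamma> t" .
  show "\<gamma> t \<le> \<gamma> 0" using assms by (simp add: gam_def)
qed

lemma kern_eq:
  assumes "0 \<le> s"
  shows "K t s = \<beta> + (tpow (\<alpha> - 1) (\<eta> - s) - tpow (\<alpha> - 1) (t - s)) / \<Gamma>"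
  using assms \<alpha> by (auto simp: kern_def indicator_def tpow_def max_def diff_divide_distrib)

text \<open>
  For fixed \<open>s\<close> the kernel decreases in \<open>t\<close>, so its maximum is at \<open>t = 0\<close>, and the overall maximum is
  \<open>K 0 0 = \<beta> + \<eta>\<^bsup>\<alpha>-1\<^esup> / \<Gamma>\<close>. Its minimum over \<open>t\<close> is at \<open>t = 1\<close>, where splitting
  \<open>1 - s = (\<eta> - s) + (1 - \<eta>)\<close> and subadditivity of the power give \<open>\<beta> - (1-\<eta>)\<^bsup>\<alpha>-1\<^esup> / \<Gamma>\<close> as a lower
  bound. The quotient of these two numbers is \<open>c1_K\<close>.
\<close>
lemma kern_bounds:
  assumes "t \<in> {0..1}" "0 \<le> s"
  shows "\<sigma> * K 0 s \<le> K t s" "K t s \<le> K 0 s" "0 \<le> K 0 s" "K 0 s \<le> K 0 0"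
proof -
  let ?p = "tpow (\<alpha> - 1)"
  have K0: "K 0 s = \<beta> + ?p (\<eta> - s) / \<Gamma>"
    using assms by (simp add: kern_eq tpow_eq_0)
  have K00: "K 0 0 = \<beta> + \<eta> powr (\<alpha> - 1) / \<Gamma>"
    using \<eta> by (simp add: kern_eq tpow_eq)
  show nonneg: "0 \<le> K 0 s"
    using K0 \<beta> Gamma_alpha_pos tpow_nonneg by (simp add: add_nonneg_nonneg)
  show "K 0 s \<le> K 0 0"
    unfolding K0 K00 using tpow_mono[of "\<alpha> - 1" "\<eta> - s" \<eta>] \<alpha> \<eta> assms Gamma_alpha_pos
    by (simp add: tpow_eq divide_right_mono)
  show "K t s \<le> K 0 s"
    using assms Gamma_alpha_pos tpow_nonneg[of "\<alpha> - 1" "t - s"] K0 by (simp add: kern_eq divide_right_mono)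
  have "\<sigma> * K 0 s \<le> c1_K \<alpha> \<beta> \<eta> * K 0 0"
    using sigma1_le sigma1_pos nonneg \<open>K 0 s \<le> K 0 0\<close> by (intro mult_mono) auto
  also have "\<dots> = \<beta> - (1 - \<eta>) powr (\<alpha> - 1) / \<Gamma>"
  proof -
    have "0 < \<beta> * \<Gamma> + \<eta> powr (\<alpha> - 1)"
      using \<beta> Gamma_alpha_pos by (auto intro: add_pos_nonneg)
    moreover have "K 0 0 = (\<beta> * \<Gamma> + \<eta> powr (\<alpha> - 1)) / \<Gamma>"
      using K00 Gamma_alpha_pos by (simp add: field_simps)
    ultimately show ?thesis
      using Gamma_alpha_pos by (simp add: c1_K_def) (simp add: diff_divide_distrib)
  qed
  also have "\<dots> \<le> K t s"
  proof -
    have "?p (t - s) \<le> ?p ((\<eta> - s) + (1 - \<eta>))"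
      using assms \<alpha> by (intro tpow_mono) auto
    also have "\<dots> \<le> ?p (\<eta> - s) + (1 - \<eta>) powr (\<alpha> - 1)"
      using \<alpha> \<eta> by (intro tpow_add_le) auto
    finally have "- ((1 - \<eta>) powr (\<alpha> - 1)) / \<Gamma> \<le> (?p (\<eta> - s) - ?p (t - s)) / \<Gamma>"
      using Gamma_alpha_pos by (intro divide_right_mono) auto
    then show ?thesis using assms by (simp add: kern_eq)
  qed
  finally show "\<sigma> * K 0 s \<le> K t s" .
qed

lemma kern_abs_le:
  assumes "t \<in> {0..1}" "0 \<le> s"
  shows "\<bar>K t s\<bar> \<le> K 0 0"
proof -
  have "0 \<le> \<sigma> * K 0 s" using kern_bounds(3)[OF assms] sigma1_pos by simp
  then show ?thesis using kern_bounds[OF assms] by simp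
qed

lemma kern_Hoelder:
  assumes "0 \<le> s"
  shows "\<bar>K t s - K t' s\<bar> \<le> \<bar>t - t'\<bar> powr (\<alpha> - 1) / \<Gamma>"
proof -
  have "\<bar>K t s - K t' s\<bar> = \<bar>tpow (\<alpha> - 1) (t' - s) - tpow (\<alpha> - 1) (t - s)\<bar> / \<Gamma>"
    using assms Gamma_alpha_pos by (simp add: kern_eq abs_divide flip: diff_divide_distrib)
  also have "\<dots> \<le> \<bar>(t' - s) - (t - s)\<bar> powr (\<alpha> - 1) / \<Gamma>"
    using \<alpha> Gamma_alpha_pos by (intro divide_right_mono tpow_Hoelder) auto
  finally show ?thesis by (simp add: abs_minus_commute)
qed

lemma continuous_on_kern: "continuous_on {0..1} (K t)"
proof -
  have "continuous_on {0..1} (\<lambda>s. \<beta> + (tpow (\<alpha> - 1) (\<eta> - s) - tpow (\<alpha> - 1) (t - s)) / \<Gamma>)"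
    using \<alpha> less_imp_neq[OF Gamma_alpha_pos] by (intro continuous_intros) auto
  then show ?thesis
    by (subst continuous_on_cong[OF refl kern_eq]) auto
qed

lemma kern_integrable [intro]:
  "continuous_on {0..1} \<phi> \<Longrightarrow> (\<lambda>s. K t s * \<phi> s) integrable_on {0..1}"
  by (intro integrable_continuous_interval continuous_intros continuous_on_kern)

lemma integral_abs_le:
  fixes g :: "real \<Rightarrow> real"
  assumes "continuous_on {0..1} g" "\<And>s. s \<in> {0..1} \<Longrightarrow> \<bar>g s\<bar> \<le> B"
  shows "\<bar>integral {0..1} g\<bar> \<le> B"
  using integral_bound[of 0 1 g B] assms by simp

lemma kern_integral_diff_t:
  assumes "continuous_on {0..1} \<phi>" "\<And>s. s \<in> {0..1} \<Longrightarrow> \<bar>\<phi> s\<bar> \<le> M"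
  shows "\<bar>integral {0..1} (\<lambda>s. K t s * \<phi> s) - integral {0..1} (\<lambda>s. K t' s * \<phi> s)\<bar>
           \<le> M / \<Gamma> * \<bar>t - t'\<bar> powr (\<alpha> - 1)"
proof -
  have "integral {0..1} (\<lambda>s. K t s * \<phi> s) - integral {0..1} (\<lambda>s. K t' s * \<phi> s)
      = integral {0..1} (\<lambda>s. (K t s - K t' s) * \<phi> s)"
    using assms(1) by (subst integral_diff[symmetric]) (auto simp: left_diff_distrib)
  also have "\<bar>\<dots>\<bar> \<le> \<bar>t - t'\<bar> powr (\<alpha> - 1) / \<Gamma> * M"
  proof (rule integral_abs_le)
    show "\<bar>(K t s - K t' s) * \<phi> s\<bar> \<le> \<bar>t - t'\<bar> powr (\<alpha> - 1) / \<Gamma> * M" if "s \<in> {0..1}" for s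
      unfolding abs_mult using that assms(2) Gamma_alpha_pos by (intro mult_mono kern_Hoelder) auto
  qed (intro continuous_intros continuous_on_kern assms(1))
  finally show ?thesis by (simp add: mult.commute)
qed

lemma kern_integral_diff:
  assumes "continuous_on {0..1} \<phi>" "continuous_on {0..1} \<psi>" "t \<in> {0..1}"
    and "\<And>s. s \<in> {0..1} \<Longrightarrow> \<bar>\<phi> s - \<psi> s\<bar> \<le> e"
  shows "\<bar>integral {0..1} (\<lambda>s. K t s * \<phi> s) - integral {0..1} (\<lambda>s. K t s * \<psi> s)\<bar> \<le> K 0 0 * e"
proof -
  have "integral {0..1} (\<lambda>s. K t s * \<phi> s) - integral {0..1} (\<lambda>s. K t s * \<psi> s)
      = integral {0..1} (\<lambda>s. K t s * (\<phi> s - \<psi> s))"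
    using assms by (subst integral_diff[symmetric]) (auto simp: right_diff_distrib)
  also have "\<bar>\<dots>\<bar> \<le> K 0 0 * e"
  proof (rule integral_abs_le)
    show "\<bar>K t s * (\<phi> s - \<psi> s)\<bar> \<le> K 0 0 * e" if "s \<in> {0..1}" for s
      unfolding abs_mult
      using that assms kern_abs_le kern_bounds(3)[of 0 0] by (intro mult_mono) auto
  qed (intro continuous_intros continuous_on_kern assms)
  finally show ?thesis .
qed

lemma kern_integral_bounds:
  assumes \<phi>: "continuous_on {0..1} \<phi>" "\<And>s. s \<in> {0..1} \<Longrightarrow> 0 \<le> \<phi> s" and t: "t \<in> {0..1}"
  shows "\<sigma> * integral {0..1} (\<lambda>s. K 0 s * \<phi> s) \<le> integral {0..1} (\<lambda>s. K t s * \<phi> s)"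
    and "integral {0..1} (\<lambda>s. K t s * \<phi> s) \<le> integral {0..1} (\<lambda>s. K 0 s * \<phi> s)"
proof -
  have "\<sigma> * integral {0..1} (\<lambda>s. K 0 s * \<phi> s) = integral {0..1} (\<lambda>s. \<sigma> * (K 0 s * \<phi> s))"
    by simp
  also have "\<dots> \<le> integral {0..1} (\<lambda>s. K t s * \<phi> s)"
  proof (rule integral_le)
    show "\<sigma> * (K 0 s * \<phi> s) \<le> K t s * \<phi> s" if "s \<in> {0..1}" for s
      using mult_right_mono[OF kern_bounds(1)[OF t, of s] \<phi>(2)[OF that]] that by (simp add: mult.assoc)
  qed (use \<phi>(1) integrable_on_cmult_left[OF kern_integrable[OF \<phi>(1)]] in auto)
  finally show "\<sigma> * integral {0..1} (\<lambda>s. K 0 s * \<phi> s) \<le> integral {0..1} (\<lambda>s. K t s * \<phi> s)" .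
  show "integral {0..1} (\<lambda>s. K t s * \<phi> s) \<le> integral {0..1} (\<lambda>s. K 0 s * \<phi> s)"
    using \<phi> t by (intro integral_le kern_integrable mult_right_mono kern_bounds) auto
qed

end

section \<open>The integral operator\<close>

locale bvp = bvp_parameters +
  fixes f :: "real \<Rightarrow> real \<Rightarrow> real" and H1 H2 :: "(real \<Rightarrow> real) \<Rightarrow> real"
  assumes f_cont: "continuous_on ({0..1} \<times> UNIV) (\<lambda>(t, x). f t x)"
    and f_nonneg: "\<And>t x. t \<in> {0..1} \<Longrightarrow> 0 \<le> f t x"
    and H1: "compact_functional H1" "\<And>u. u \<in> C01 \<Longrightarrow> 0 \<le> H1 u"
    and H2: "compact_functional H2" "\<And>u. u \<in> C01 \<Longrightarrow> 0 \<le> H2 u"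
begin

abbreviation "T \<equiv> T_op \<alpha> \<beta> \<eta> f H1 H2"

lemma continuous_on_superposition:
  assumes "u \<in> C01"
  shows "continuous_on {0..1} (\<lambda>s. f s (u s))"
proof -
  have "continuous_on {0..1} u" using assms C01_iff by blast
  then have "continuous_on {0..1} (\<lambda>s. case (s, u s) of (t, x) \<Rightarrow> f t x)"
    by (intro continuous_on_compose2[OF f_cont] continuous_intros) auto
  then show ?thesis by simp
qed

text \<open>
  \<open>T u\<close> inherits its maximum at \<open>0\<close> from \<open>\<gamma>\<close> and the kernel. Therefore \<open>T u 0\<close> is the supremum
  norm of \<open>T u\<close>, and the first inequality says that \<open>T u\<close> is in the cone.
\<close>
lemma T_bounds:
  assumes u: "u \<in> C01" and t: "t \<in> {0..1}"
  shows "\<sigma> * T u 0 \<le> T u t" "T u t \<le> T u 0"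
proof -
  note I = kern_integral_bounds[OF continuous_on_superposition[OF u] f_nonneg t]
  have "H1 u * (\<sigma> * \<gamma> 0) \<le> H1 u * \<gamma> t" "H1 u * \<gamma> t \<le> H1 u * \<gamma> 0"
    using gam_bounds[OF t] H1(2)[OF u] by (auto intro: mult_left_mono)
  moreover have "\<sigma> * H2 u \<le> 1 * H2 u"
    using sigma1_le H2(2)[OF u] by (intro mult_right_mono) auto
  ultimately show "\<sigma> * T u 0 \<le> T u t" "T u t \<le> T u 0"
    unfolding T_op_def distrib_left mult.left_commute[of \<sigma> "H1 u"] using I by linarith+
qed

text \<open>
  The constant involves \<open>u\<close> only through \<open>H1 u\<close> and a bound for \<open>f\<close>, both of which are bounded as \<open>u\<close>
  runs through a bounded set. So \<open>T\<close> maps bounded sets to equicontinuous ones.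
\<close>
lemma T_Hoelder:
  assumes u: "u \<in> C01" and M: "\<And>s. s \<in> {0..1} \<Longrightarrow> f s (u s) \<le> M"
    and st: "s \<in> {0..1}" "t \<in> {0..1}"
  shows "\<bar>T u s - T u t\<bar> \<le> (H1 u + M / \<Gamma>) * \<bar>s - t\<bar> powr (\<alpha> - 1)"
proof -
  have "\<bar>s - t\<bar> \<le> \<bar>s - t\<bar> powr (\<alpha> - 1)"
    using powr_mono'[of "\<alpha> - 1" 1 "\<bar>s - t\<bar>"] st \<alpha> by (cases "s = t") auto
  then have "H1 u * \<bar>s - t\<bar> \<le> H1 u * \<bar>s - t\<bar> powr (\<alpha> - 1)"
    using H1(2)[OF u] by (rule mult_left_mono)
  moreover have "\<bar>H1 u * \<gamma> s - H1 u * \<gamma> t\<bar> = H1 u * \<bar>s - t\<bar>"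
    using H1(2)[OF u]
    by (simp add: gam_def abs_mult abs_minus_commute flip: right_diff_distrib)
  moreover have "\<bar>integral {0..1} (\<lambda>r. K s r * f r (u r)) - integral {0..1} (\<lambda>r. K t r * f r (u r))\<bar>
           \<le> M / \<Gamma> * \<bar>s - t\<bar> powr (\<alpha> - 1)"
    using M f_nonneg by (intro kern_integral_diff_t continuous_on_superposition[OF u]) auto
  ultimately show ?thesis
    unfolding T_op_def distrib_right by linarith
qed

lemma continuous_on_T:
  assumes "u \<in> C01"
  shows "continuous_on {0..1} (T u)"
proof -
  obtain M where M: "\<And>s. s \<in> {0..1} \<Longrightarrow> f s (u s) \<le> M"
    using compact_imp_bounded[OF compact_continuous_image[OF continuous_on_superposition[OF assms]]]
    unfolding bounded_iff by (metis abs_le_D1 compact_Icc image_eqI real_norm_def)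
  let ?L = "H1 u + M / \<Gamma>"
  have "(T u \<longlongrightarrow> T u t) (at t within {0..1})" if t: "t \<in> {0..1}" for t
  proof -
    have "((\<lambda>s. ?L * \<bar>s - t\<bar> powr (\<alpha> - 1)) \<longlongrightarrow> ?L * \<bar>t - t\<bar> powr (\<alpha> - 1)) (at t within {0..1})"
      using \<alpha> by (intro tendsto_intros tendsto_powr') (auto intro!: always_eventually)
    then have "((\<lambda>s. ?L * \<bar>s - t\<bar> powr (\<alpha> - 1)) \<longlongrightarrow> 0) (at t within {0..1})"
      by simp
    then have "((\<lambda>s. T u s - T u t) \<longlongrightarrow> 0) (at t within {0..1})"
      by (rule Lim_null_comparison[rotated])
        (use T_Hoelder[OF assms M _ t] in \<open>auto simp: eventually_at_filter\<close>)
    then show ?thesis by (rule LIM_zero_cancel)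
  qed
  then show ?thesis by (auto simp: continuous_on_def)
qed

text \<open>
  On \<open>[0,1]\<close>, a retraction of the whole space onto the functions with values in \<open>[\<sigma>\<rho>, \<rho>]\<close> whose value at \<open>0\<close> is
  \<open>\<rho>\<close>: adding a constant makes the value at \<open>0\<close> right, and truncation the range. All its values lie in
  the cone and on the sphere of radius \<open>\<rho>\<close>, where the hypotheses on \<open>f\<close>, \<open>H1\<close> and \<open>H2\<close> hold.
\<close>
definition push_out :: "real \<Rightarrow> (real \<Rightarrow>\<^sub>C real) \<Rightarrow> real \<Rightarrow> real" where
  "push_out \<rho> v = (\<lambda>t\<in>{0..1}. max (\<sigma> * \<rho>) (min \<rho> (v t + (\<rho> - v 0))))"

lemma push_out_C01: "push_out \<rho> v \<in> C01"
  unfolding push_out_def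
  by (intro C01_restrict continuous_on_max continuous_on_min continuous_intros) auto

lemma push_out_diff: "\<bar>push_out \<rho> v t - push_out \<rho> w t\<bar> \<le> 2 * dist v w"
proof -
  have "dist (v t) (w t) \<le> dist v w" "dist (v 0) (w 0) \<le> dist v w"
    by (rule dist_bounded)+
  then have "\<bar>(v t + (\<rho> - v 0)) - (w t + (\<rho> - w 0))\<bar> \<le> 2 * dist v w"
    unfolding dist_real_def by linarith
  moreover have "\<bar>max c (min \<rho> x) - max c (min \<rho> y)\<bar> \<le> \<bar>x - y\<bar>" for c x y :: real
    by linarith
  ultimately show ?thesis
    unfolding push_out_def restrict_def by (auto intro: order_trans)
qed

lemma push_out_bounds:
  assumes "\<rho> > 0"
  shows "push_out \<rho> v 0 = \<rho>"
    and "t \<in> {0..1} \<Longrightarrow> \<sigma> * \<rho> \<le> push_out \<rho> v t" "t \<in> {0..1} \<Longrightarrow> push_out \<rho> v t \<le> \<rho>"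
proof -
  have "\<sigma> * \<rho> \<le> 1 * \<rho>" using sigma1_le assms by (intro mult_right_mono) auto
  then show "push_out \<rho> v 0 = \<rho>"
    "t \<in> {0..1} \<Longrightarrow> \<sigma> * \<rho> \<le> push_out \<rho> v t" "t \<in> {0..1} \<Longrightarrow> push_out \<rho> v t \<le> \<rho>"
    by (auto simp: push_out_def)
qed

lemma continuous_map_push_out: "continuous_map euclidean C01_topology (push_out \<rho>)"
proof -
  have "Lipschitz_continuous_map euclidean_metric C01_metric (push_out \<rho>)"
    unfolding Lipschitz_continuous_map_def
  proof (intro conjI exI[of _ 2] ballI)
    fix v w :: "real \<Rightarrow>\<^sub>C real"
    show "mdist C01_metric (push_out \<rho> v) (push_out \<rho> w) \<le> 2 * mdist euclidean_metric v w"
      unfolding mdist_C01[OF push_out_C01 push_out_C01]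
        supnorm_le_iff[OF C01_diff[OF push_out_C01 push_out_C01]]
      using push_out_diff[of \<rho> v _ w] by auto
  qed (use push_out_C01 in blast)
  from Lipschitz_continuous_imp_continuous_map[OF this] show ?thesis by simp
qed


text \<open>
  The continuity of \<open>T\<close> in quantitative form: the right-hand side does not depend on \<open>t\<close>.
\<close>
lemma T_diff:
  assumes "u \<in> C01" "w \<in> C01" "t \<in> {0..1}"
    and "\<And>s. s \<in> {0..1} \<Longrightarrow> \<bar>f s (u s) - f s (w s)\<bar> \<le> e"
  shows "\<bar>T u t - T w t\<bar> \<le> \<bar>H1 u - H1 w\<bar> * \<gamma> 0 + \<bar>H2 u - H2 w\<bar> + K 0 0 * e"
proof -
  have "0 \<le> \<sigma> * \<gamma> 0" using sigma1_pos gam_0_pos by simp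
  then have "\<bar>\<gamma> t\<bar> \<le> \<gamma> 0"
    using gam_bounds[OF assms(3)] by simp
  then have "\<bar>H1 u * \<gamma> t - H1 w * \<gamma> t\<bar> \<le> \<bar>H1 u - H1 w\<bar> * \<gamma> 0"
    by (simp add: abs_mult mult_left_mono flip: left_diff_distrib)
  moreover have "\<bar>integral {0..1} (\<lambda>s. K t s * f s (u s)) - integral {0..1} (\<lambda>s. K t s * f s (w s))\<bar>
      \<le> K 0 0 * e"
    using assms by (intro kern_integral_diff continuous_on_superposition) auto
  ultimately show ?thesis
    unfolding T_op_def by linarith
qed

text \<open>
  \<open>T\<close> after the retraction, as a self-map of the Banach space of bounded continuous functions on
  the line; outside \<open>[0,1]\<close> the values are those at the nearer end point.
\<close>
definition T_ext :: "real \<Rightarrow> (real \<Rightarrow>\<^sub>C real) \<Rightarrow> (real \<Rightarrow>\<^sub>C real)" where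
  "T_ext \<rho> v = Bcontfun (\<lambda>t. T (push_out \<rho> v) (clamp 0 1 t))"

lemma apply_T_ext: "T_ext \<rho> v t = T (push_out \<rho> v) (clamp 0 1 t)"
proof -
  have "continuous_on (cbox 0 1) (T (push_out \<rho> v))"
    using continuous_on_T[OF push_out_C01] by simp
  then obtain g :: "real \<Rightarrow>\<^sub>C real" where g: "\<And>t. g t = T (push_out \<rho> v) (clamp 0 1 t)"
    by (rule continuous_on_cbox_bcontfunE) blast
  then have "T_ext \<rho> v = g"
    by (simp add: T_ext_def apply_bcontfun_inverse flip: g)
  then show ?thesis by (simp add: g)
qed

lemma clamp_unit: "clamp 0 1 (t::real) \<in> {0..1}"
  using clamp_in_interval[of 0 1 t] by simp

lemma push_out_graph:
  assumes "\<rho> > 0" "s \<in> {0..1}"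
  shows "(s, push_out \<rho> v s) \<in> {0..1} \<times> {0..\<rho>}"
proof -
  have "0 \<le> \<sigma> * \<rho>" using sigma1_pos assms by simp
  then show ?thesis
    using push_out_bounds(2,3)[OF assms, of v] assms(2) by (auto intro: order_trans)
qed

lemma f_cont_box: "continuous_on ({0..1} \<times> {0..\<rho>}) (\<lambda>(t, x). f t x)"
  using f_cont by (rule continuous_on_subset) auto

lemma continuous_on_T_ext:
  assumes \<rho>: "\<rho> > 0"
  shows "continuous_on UNIV (T_ext \<rho>)"
proof -
  let ?P = "push_out \<rho>" and ?D = "{0..1} \<times> {0..\<rho>}"
  have contH: "((\<lambda>w. H (?P w)) \<longlongrightarrow> H (?P v)) (at v)" if "compact_functional H" for H v
  proof -
    have "continuous_map euclidean euclideanreal (H \<circ> ?P)"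
      using that
      by (intro continuous_map_compose[OF continuous_map_push_out]) (simp add: compact_functional_def)
    then have "continuous_on UNIV (\<lambda>w. H (?P w))" by (simp add: o_def)
    then show ?thesis by (simp add: continuous_on_def)
  qed
  have "(T_ext \<rho> \<longlongrightarrow> T_ext \<rho> v) (at v)" for v
  proof (rule tendstoI)
    fix e :: real assume "e > 0"
    have K00: "0 \<le> K 0 0" using kern_bounds(3)[of 0 0] by simp
    define r where "r w = \<bar>H1 (?P w) - H1 (?P v)\<bar> * \<gamma> 0 + \<bar>H2 (?P w) - H2 (?P v)\<bar>" for w
    define e' where "e' = e / (2 * (K 0 0 + 1))"
    have "e' > 0" using \<open>e > 0\<close> K00 by (simp add: e'_def)
    have Ke': "K 0 0 * e' \<le> e / 2"
      using \<open>e > 0\<close> K00 by (simp add: e'_def field_simps)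
    have "(r \<longlongrightarrow> \<bar>H1 (?P v) - H1 (?P v)\<bar> * \<gamma> 0 + \<bar>H2 (?P v) - H2 (?P v)\<bar>) (at v)"
      unfolding r_def by (intro tendsto_intros contH H1 H2)
    then have r: "\<forall>\<^sub>F w in at v. r w < e / 2"
      by (rule order_tendstoD) (use \<open>e > 0\<close> in simp)
    have "uniformly_continuous_on ?D (\<lambda>(t, x). f t x)"
      by (intro compact_uniformly_continuous f_cont_box compact_Times) auto
    then obtain d where "d > 0"
      and d: "\<And>p q. p \<in> ?D \<Longrightarrow> q \<in> ?D \<Longrightarrow> dist q p < d \<Longrightarrow>
                dist (case q of (t, x) \<Rightarrow> f t x) (case p of (t, x) \<Rightarrow> f t x) < e'"
      using \<open>e' > 0\<close> unfolding uniformly_continuous_on_def by metis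
    have near: "\<forall>\<^sub>F w in at v. dist w v < d / 2"
      using \<open>d > 0\<close> tendstoD[OF tendsto_ident_at, of "d/2" v UNIV] by simp
    from r near show "\<forall>\<^sub>F w in at v. dist (T_ext \<rho> w) (T_ext \<rho> v) < e"
    proof eventually_elim
      case (elim w)
      have ff: "\<bar>f s (?P w s) - f s (?P v s)\<bar> \<le> e'" if "s \<in> {0..1}" for s
      proof -
        have "dist (s, ?P w s) (s, ?P v s) < d"
          using push_out_diff[of \<rho> w s v] elim(2) by (simp add: dist_Pair_Pair dist_real_def)
        from d[OF push_out_graph[OF \<rho> that] push_out_graph[OF \<rho> that] this] show ?thesis
          by (simp add: dist_real_def)
      qed
      have "dist (T_ext \<rho> w) (T_ext \<rho> v) \<le> r w + K 0 0 * e'"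
      proof (rule dist_bound)
        fix t
        show "dist (T_ext \<rho> w t) (T_ext \<rho> v t) \<le> r w + K 0 0 * e'"
          using T_diff[OF push_out_C01 push_out_C01 clamp_unit ff, of t]
          by (simp add: apply_T_ext r_def dist_real_def)
      qed
      with elim(1) Ke' show ?case by linarith
    qed
  qed
  then show ?thesis by (simp add: continuous_on_def)
qed

section \<open>Existence of an eigenfunction\<close>

text \<open>
  The Birkhoff--Kellogg argument for maps whose values take their maximum at \<open>0\<close>. The sphere of the
  cone is not convex, but \<open>v \<mapsto> (\<rho> / T (push_out \<rho> v) 0) T (push_out \<rho> v)\<close> is defined and continuous on the
  whole space, and its range is bounded and uniformly Hoelder continuous. A fixed point \<open>v\<close> satisfies
  \<open>v 0 = \<rho>\<close> and \<open>\<sigma>\<rho> \<le> v \<le> \<rho>\<close>, hence \<open>push_out\<close> leaves it unchanged on \<open>[0,1]\<close>, and \<open>v\<close> is an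
  eigenfunction.
\<close>
lemma T_eigenfunction:
  assumes \<rho>: "\<rho> > 0" and "c > 0" and c: "\<And>v. c \<le> T (push_out \<rho> v) 0"
  obtains lam u where "lam > 0" "u \<in> C01" "u 0 = \<rho>"
    "\<And>t. t \<in> {0..1} \<Longrightarrow> \<sigma> * \<rho> \<le> u t \<and> u t \<le> \<rho>" "\<And>t. t \<in> {0..1} \<Longrightarrow> u t = lam * T u t"
proof -
  let ?P = "push_out \<rho>"
  obtain M where M: "\<And>v s. s \<in> {0..1} \<Longrightarrow> f s (?P v s) \<le> M"
  proof -
    have "bounded ((\<lambda>(t, x). f t x) ` ({0..1} \<times> {0..\<rho>}))"
      by (intro compact_imp_bounded compact_continuous_image f_cont_box compact_Times) auto
    then obtain M where "\<And>p. p \<in> {0..1} \<times> {0..\<rho>} \<Longrightarrow> \<bar>case p of (t, x) \<Rightarrow> f t x\<bar> \<le> M"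
      unfolding bounded_iff by auto
    from this[OF push_out_graph[OF \<rho>]] show thesis
      by (intro that[of M]) (auto dest: abs_le_D1)
  qed
  have sup: "supnorm (?P v) = \<rho>" for v
    using on_sphere_in_cone(1)[OF push_out_C01 less_imp_le[OF sigma1_pos]] push_out_bounds[OF \<rho>] \<rho>
    by blast
  obtain b where b: "\<And>v. H1 (?P v) \<le> b"
    using compact_functional_bounded[OF H1(1), of \<rho>] push_out_C01 sup
    by (metis abs_le_D1 order_refl)
  define g where "g v = (\<rho> / T (?P v) 0) *\<^sub>R T_ext \<rho> v" for v
  have T0: "T (?P v) 0 > 0" for v using c[of v] \<open>c > 0\<close> by linarith
  have g: "g v t = \<rho> / T (?P v) 0 * T (?P v) (clamp 0 1 t)" for v t
    by (simp add: g_def apply_T_ext)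
  have clamp_id: "clamp 0 1 t = t" if "t \<in> {0..1}" for t :: real
    using that by simp
  have g_bounds: "\<sigma> * \<rho> \<le> g v t" "g v t \<le> \<rho>" for v t
  proof -
    have "\<rho> / T (?P v) 0 * (\<sigma> * T (?P v) 0) \<le> g v t" "g v t \<le> \<rho> / T (?P v) 0 * T (?P v) 0"
      unfolding g using T0[of v] \<rho>
      by (intro mult_left_mono T_bounds[OF push_out_C01 clamp_unit]; simp)+
    then show "\<sigma> * \<rho> \<le> g v t" "g v t \<le> \<rho>"
      using T0[of v] by (simp_all add: mult.commute)
  qed
  define L where "L = \<rho> / c * (b + M / \<Gamma>)"
  define \<omega> where "\<omega> h = L * \<bar>h\<bar> powr (\<alpha> - 1)" for h :: real
  have "H1 (?P 0) \<ge> 0" "f 0 (?P 0 0) \<ge> 0"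
    by (auto intro: H1 f_nonneg push_out_C01)
  then have nonneg: "0 \<le> b" "0 \<le> M"
    using b[of 0] M[of 0 0] by auto
  have g_Hoelder: "\<bar>g v s - g v t\<bar> \<le> \<omega> (s - t)" for v s t
  proof -
    have "\<bar>g v s - g v t\<bar> = \<rho> / T (?P v) 0 * \<bar>T (?P v) (clamp 0 1 s) - T (?P v) (clamp 0 1 t)\<bar>"
      unfolding g right_diff_distrib[symmetric] abs_mult using T0[of v] \<rho> by simp
    also have "\<dots> \<le> \<rho> / c * ((b + M / \<Gamma>) * \<bar>s - t\<bar> powr (\<alpha> - 1))"
    proof (rule mult_mono)
      show "\<rho> / T (?P v) 0 \<le> \<rho> / c"
        using c[of v] \<open>c > 0\<close> \<rho> by (intro divide_left_mono) auto
      have "\<bar>T (?P v) (clamp 0 1 s) - T (?P v) (clamp 0 1 t)\<bar>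
          \<le> (H1 (?P v) + M / \<Gamma>) * \<bar>clamp 0 1 s - clamp 0 1 t\<bar> powr (\<alpha> - 1)"
        by (intro T_Hoelder push_out_C01 M clamp_unit)
      also have "\<dots> \<le> (b + M / \<Gamma>) * \<bar>s - t\<bar> powr (\<alpha> - 1)"
        using b[of v] nonneg Gamma_alpha_pos \<alpha> dist_clamps_le_dist_args[of 0 1 s t]
        by (intro mult_mono powr_mono2) (auto simp: dist_real_def)
      finally show "\<bar>T (?P v) (clamp 0 1 s) - T (?P v) (clamp 0 1 t)\<bar>
          \<le> (b + M / \<Gamma>) * \<bar>s - t\<bar> powr (\<alpha> - 1)" .
    qed (use \<rho> \<open>c > 0\<close> in auto)
    finally show ?thesis by (simp add: \<omega>_def L_def mult.assoc)
  qed
  define S where "S = {v :: real \<Rightarrow>\<^sub>C real. (\<forall>t. \<bar>v t\<bar> \<le> \<rho>) \<and> (\<forall>s t. \<bar>v s - v t\<bar> \<le> \<omega> (s - t)) \<and>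
                    (\<forall>t. v t = v (clamp 0 1 t))}"
  have "(\<omega> \<longlongrightarrow> L * \<bar>0\<bar> powr (\<alpha> - 1)) (at 0)"
    unfolding \<omega>_def using \<alpha>
    by (intro tendsto_intros tendsto_powr') (auto intro!: always_eventually)
  then have "compact S"
    unfolding S_def by (intro compact_equicontinuous_clamped) (simp_all add: \<omega>_def[of 0])
  moreover have "g ` UNIV \<subseteq> S"
  proof (clarsimp simp: S_def g_Hoelder)
    fix v
    have "0 \<le> \<sigma> * \<rho>" using sigma1_pos \<rho> by simp
    then have "\<bar>g v t\<bar> \<le> \<rho>" for t using g_bounds[of v t] by linarith
    moreover have "g v t = g v (clamp 0 1 t)" for t
      unfolding g using clamp_id[OF clamp_unit] by simp
    ultimately show "(\<forall>t. \<bar>g v t\<bar> \<le> \<rho>) \<and> (\<forall>t. g v t = g v (clamp 0 1 t))" by blast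
  qed
  moreover have "continuous_on UNIV g"
  proof -
    have "continuous_on UNIV (\<lambda>v. T_ext \<rho> v 0)"
      by (rule bounded_linear.continuous_on[OF bounded_linear_apply_bcontfun continuous_on_T_ext[OF \<rho>]])
    then have "continuous_on UNIV (\<lambda>v. T (?P v) 0)"
      by (simp add: apply_T_ext clamp_id)
    then show ?thesis
      unfolding g_def using less_imp_neq[OF T0, symmetric]
      by (intro continuous_intros continuous_on_T_ext[OF \<rho>]) auto
  qed
  ultimately obtain v where v: "g v = v"
    using Schauder_fixed_point[of UNIV S g] by auto
  have v0: "v 0 = \<rho>"
    using g[of v 0] T0[of v] v by (simp add: clamp_id)
  have Pv: "?P v t = v t" if "t \<in> {0..1}" for t
    using that g_bounds[of v t] v0 v by (simp add: push_out_def)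
  show thesis
  proof
    show "0 < \<rho> / T (?P v) 0" using \<rho> T0 by simp
    show "?P v t = \<rho> / T (?P v) 0 * T (?P v) t" if "t \<in> {0..1}" for t
      using g[of v t] Pv[OF that] clamp_id[OF that] v by simp
  qed (use push_out_C01 push_out_bounds[OF \<rho>] in auto)
qed

text \<open>
  At \<open>t = 0\<close> all coefficients in \<open>T u\<close> are nonnegative, so lower bounds for \<open>H1 u\<close>, \<open>H2 u\<close> and \<open>f\<close> pass
  to \<open>T u 0\<close>. This keeps the norm of \<open>T u\<close> away from \<open>0\<close>, as the normalisation requires.
\<close>
lemma T_lower_bound:
  assumes u: "u \<in> C01" and "\<eta>1 \<le> H1 u" "\<eta>2 \<le> H2 u"
    and \<delta>: "continuous_on {0..1} \<delta>" "\<And>s. s \<in> {0..1} \<Longrightarrow> \<delta> s \<le> f s (u s)"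
  shows "\<gamma> 0 * \<eta>1 + \<eta>2 + integral {0..1} (\<lambda>s. K 0 s * \<delta> s) \<le> T u 0"
proof -
  have "\<gamma> 0 * \<eta>1 \<le> H1 u * \<gamma> 0"
    using assms(2) gam_0_pos by (simp add: mult.commute)
  moreover have "integral {0..1} (\<lambda>s. K 0 s * \<delta> s) \<le> integral {0..1} (\<lambda>s. K 0 s * f s (u s))"
    using \<delta> continuous_on_superposition[OF u]
    by (intro integral_le kern_integrable mult_left_mono kern_bounds(3)) auto
  ultimately show ?thesis
    using assms(3) by (simp add: T_op_def)
qed

end

theorem theorem3p2:
  fixes \<alpha> \<beta> \<eta> \<rho> \<eta>1 \<eta>2 :: real
    and f :: "real \<Rightarrow> real \<Rightarrow> real"
    and H1 H2 :: "(real \<Rightarrow> real) \<Rightarrow> real"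
    and \<delta> :: "real \<Rightarrow> real"
  assumes "1 < \<alpha>" "\<alpha> \<le> 2" "0 < \<eta>" "\<eta> < 1" "0 < \<beta>"
    and f_cont: "continuous_on ({0..1} \<times> UNIV) (\<lambda>(t, x). f t x)"
    and f_nonneg: "\<And>t x. t \<in> {0..1} \<Longrightarrow> 0 \<le> f t x"
    and H1: "compact_functional H1" "\<And>u. u \<in> C01 \<Longrightarrow> 0 \<le> H1 u"
    and H2: "compact_functional H2" "\<And>u. u \<in> C01 \<Longrightarrow> 0 \<le> H2 u"
    and beta: "\<beta> > max (beta_K \<alpha> \<eta>) (beta_gam \<alpha> \<eta>)"
    and "0 < \<rho>"
    and delta: "continuous_on {0..1} \<delta>" "\<And>t. t \<in> {0..1} \<Longrightarrow> 0 \<le> \<delta> t"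
    and f_ge: "\<And>t x. t \<in> {0..1} \<Longrightarrow> x \<in> {sigma1 \<alpha> \<beta> \<eta> * \<rho>..\<rho>} \<Longrightarrow> \<delta> t \<le> f t x"
    and "0 \<le> \<eta>1" "0 \<le> \<eta>2"
    and H_ge: "\<And>u. u \<in> P_cone (sigma1 \<alpha> \<beta> \<eta>) \<inter> (C01_topology frontier_of Omega \<rho>)
                 \<Longrightarrow> \<eta>1 \<le> H1 u \<and> \<eta>2 \<le> H2 u"
    and pos: "gam \<alpha> \<beta> \<eta> 0 * \<eta>1 + \<eta>2 + integral {0..1} (\<lambda>s. kern \<alpha> \<beta> \<eta> 0 s * \<delta> s) > 0"
  shows "\<exists>lam>0. \<exists>u \<in> P_cone (sigma1 \<alpha> \<beta> \<eta>) \<inter> (C01_topology closure_of Omega \<rho>).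
           mild_solution \<alpha> \<beta> \<eta> f H1 H2 lam u \<and>
           (\<forall>t\<in>{0..1}. sigma1 \<alpha> \<beta> \<eta> * \<rho> \<le> u t \<and> u t \<le> \<rho>)"
proof -
  interpret bvp \<alpha> \<beta> \<eta> f H1 H2
    by unfold_locales (fact assms)+
  note \<rho> = \<open>0 < \<rho>\<close>
  have on_shell: "supnorm u = \<rho>" "u \<in> P_cone \<sigma>"
    if "u \<in> C01" "u 0 = \<rho>" "\<And>t. t \<in> {0..1} \<Longrightarrow> \<sigma> * \<rho> \<le> u t \<and> u t \<le> \<rho>" for u
    using on_sphere_in_cone[OF that(1) less_imp_le[OF sigma1_pos] _ _ that(2) \<rho>] that(3) by blast+
  have "gam \<alpha> \<beta> \<eta> 0 * \<eta>1 + \<eta>2 + integral {0..1} (\<lambda>s. kern \<alpha> \<beta> \<eta> 0 s * \<delta> s)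
      \<le> T (push_out \<rho> v) 0" for v
  proof (rule T_lower_bound[OF push_out_C01 _ _ delta(1)])
    have "push_out \<rho> v \<in> P_cone \<sigma> \<inter> (C01_topology frontier_of Omega \<rho>)"
      using on_shell[OF push_out_C01 push_out_bounds(1)[OF \<rho>]] push_out_bounds(2,3)[OF \<rho>]
      by (auto simp: frontier_Omega[OF \<rho>] push_out_C01)
    then show "\<eta>1 \<le> H1 (push_out \<rho> v)" "\<eta>2 \<le> H2 (push_out \<rho> v)"
      using H_ge by blast+
    show "\<delta> s \<le> f s (push_out \<rho> v s)" if "s \<in> {0..1}" for s
      using f_ge push_out_bounds(2,3)[OF \<rho> that] that by simp
  qed
  then obtain lam u where "lam > 0" and u: "u \<in> C01" "u 0 = \<rho>"
    "\<And>t. t \<in> {0..1} \<Longrightarrow> \<sigma> * \<rho> \<le> u t \<and> u t \<le> \<rho>" and "\<And>t. t \<in> {0..1} \<Longrightarrow> u t = lam * T u t"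
    using T_eigenfunction[OF \<rho> pos] by blast
  moreover have "u \<in> P_cone \<sigma> \<inter> (C01_topology closure_of Omega \<rho>)"
    using on_shell[OF u] u(1) by (simp add: closure_Omega[OF \<rho>])
  ultimately show ?thesis
    unfolding mild_solution_def by blast
qed

end
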